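(* Let $z_1,z_2,\ldots,z_n$ be complex numbers listed in descending order of modulus (not necessarily distinct), let $A_n(z)=\prod_{j=1}^n(z-z_j)$, and let $\gamma=(\gamma_1,\ldots,\gamma_n)$ be nonnegative real numbers with $\sum_{k=1}^n\gamma_k=1$. Let $w_1,w_2,\ldots,w_{n-1}$ denote the zeros (counted with multiplicity) of $A_n^\gamma(z)$ listed in descending order of modulus, and put $w_n:=0$. Then $$\prod_{j=1}^k|w_j|\le\prod_{j=1}^k|z_j|,\qquad \text{for } 1\le k\le n.$$
   Context: For complex numbers $z_1,\ldots,z_n$, the incomplete polynomials are $g_k(z)=\prod_{j=1,\,j\ne k}^n(z-z_j)$, $1\le k\le n$. For nonnegative reals $\gamma=(\gamma_1,\ldots,\gamma_n)$ with $\sum_{k=1}^n\gamma_k=1$, $A_n^\gamma(z)=\sum_{k=1}^n\gamma_k g_k(z)$, a monic polynomial of degree $n-1$. *)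

theory Defs
  imports "HOL-Computational_Algebra.Computational_Algebra"
begin

definition incomplete_poly :: "nat \<Rightarrow> (nat \<Rightarrow> complex) \<Rightarrow> nat \<Rightarrow> complex poly" where
  "incomplete_poly n z k = (\<Prod>j\<in>{1..n} - {k}. [:- z j, 1:])"

definition gen_derivative ::
    "nat \<Rightarrow> (nat \<Rightarrow> real) \<Rightarrow> (nat \<Rightarrow> complex) \<Rightarrow> complex poly" where
  "gen_derivative n \<gamma> z = (\<Sum>k=1..n. smult (of_real (\<gamma> k)) (incomplete_poly n z k))"

definition descending_modulus :: "nat \<Rightarrow> (nat \<Rightarrow> complex) \<Rightarrow> bool" where
  "descending_modulus m u \<longleftrightarrow> (\<forall>i j. 1 \<le> i \<and> i \<le> j \<and> j \<le> m \<longrightarrow> norm (u j) \<le> norm (u i))"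

text \<open>\<^const>\<open>proots\<close> is the multiset of roots of a nonzero polynomial, each taken with its
  multiplicity; it is empty for the zero polynomial.\<close>

definition lists_zeros :: "nat \<Rightarrow> (nat \<Rightarrow> complex) \<Rightarrow> complex poly \<Rightarrow> bool" where
  "lists_zeros m u p \<longleftrightarrow> image_mset u (mset_set {1..m}) = proots p"

end

theory Submission
  imports Defs "HOL-Complex_Analysis.Conformal_Mappings"
begin

text \<open>
  For a radius \<open>c\<close> different from all \<open>\<bar>z\<^sub>j\<bar>\<close>, Jensen-type products are compared on the circle
  \<open>\<bar>s\<bar> = c\<close>. Replacing a linear factor \<open>s - a\<close> with \<open>\<bar>a\<bar> < c\<close> by \<open>(c\<^sup>2 - cnj a * s) / c\<close> keeps the
  modulus on the circle, moves the zero out of the disc, and makes the value at 0 have modulus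
  \<open>max c \<bar>a\<bar>\<close>. On the circle, each term \<open>s / (s - z\<^sub>k)\<close> of the logarithmic derivative is, up to
  conjugation or reflection in the line \<open>Re = 1/2\<close>, the boundary value of a function \<open>1 / (1 - t)\<close>
  that is holomorphic in the disc, has real part at least \<open>1/2\<close>, and takes the value 1 at 0.
  Neither change decreases the absolute value of the real part, and both keep the size of the
  imaginary part with a common sign, so the weighted sum of these functions dominates the weighted
  logarithmic derivative on the circle and has no zeros in the disc. The maximum principle, evaluated at 0,
  gives \<open>\<Prod>\<^sub>j max c \<bar>w\<^sub>j\<bar> \<le> \<Prod>\<^sub>j max c \<bar>z\<^sub>j\<bar>\<close>; letting \<open>c\<close> decrease to \<open>\<bar>z\<^sub>k\<bar>\<close> proves the theorem.
\<close>

section \<open>Factors without zeros in the disc\<close>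

definition outer_factor :: "real \<Rightarrow> complex \<Rightarrow> complex \<Rightarrow> complex" where
  "outer_factor c a s =
     (if norm a < c then (of_real (c\<^sup>2) - cnj a * s) / of_real c else s - a)"

text \<open>For \<open>norm a < c\<close> the outer factor is \<open>s - a\<close> divided by the
  Blaschke factor of the disc of radius \<open>c\<close> with zero \<open>a\<close>, which is
  unimodular on the circle.\<close>

lemma norm_outer_factor_circle:
  assumes "c > 0" "norm s = c"
  shows "norm (outer_factor c a s) = norm (s - a)"
proof (cases "norm a < c")
  case True
  have "of_real (c\<^sup>2) - cnj a * s = s * cnj (s - a)"
    using assms by (simp add: algebra_simps flip: complex_norm_square)
  then show ?thesis
    using assms True by (simp add: outer_factor_def norm_mult norm_divide del: complex_cnj_diff)
qed (simp add: outer_factor_def)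

lemma norm_outer_factor_0:
  assumes "c > 0"
  shows "norm (outer_factor c a 0) = max c (norm a)"
  using assms by (auto simp: outer_factor_def power2_eq_square)

lemma outer_factor_nonzero:
  assumes "c > 0" "norm s \<le> c" "norm a \<noteq> c"
  shows "outer_factor c a s \<noteq> 0"
proof (cases "norm a < c")
  case True
  have "norm a * norm s \<le> norm a * c"
    using assms by (simp add: mult_left_mono)
  also have "\<dots> < c * c"
    using True assms by simp
  finally have "norm (cnj a * s) < c\<^sup>2"
    by (simp add: norm_mult power2_eq_square)
  moreover have "norm (complex_of_real (c\<^sup>2)) = c\<^sup>2"
    by (simp only: norm_of_real) simp
  ultimately have "complex_of_real (c\<^sup>2) \<noteq> cnj a * s"
    by (metis order_less_irrefl)
  then show ?thesis
    using True assms by (simp add: outer_factor_def)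
next
  case False
  then show ?thesis using assms by (auto simp: outer_factor_def)
qed

lemma outer_factor_holomorphic [holomorphic_intros]: "outer_factor c a holomorphic_on S"
  by (cases "norm a < c") (auto simp: outer_factor_def[abs_def] intro!: holomorphic_intros)

section \<open>Half-plane functions replacing the terms of the logarithmic derivative\<close>

definition ratio :: "real \<Rightarrow> complex \<Rightarrow> complex \<Rightarrow> complex" where
  "ratio c a s = (if norm a < c then cnj a * s / of_real (c\<^sup>2) else s / a)"

lemma norm_ratio_le_1:
  assumes "c > 0" "norm s \<le> c"
  shows "norm (ratio c a s) \<le> 1"
proof (cases "norm a < c")
  case True
  have "norm a * norm s \<le> c\<^sup>2"
    using True assms unfolding power2_eq_square by (intro mult_mono) auto
  then show ?thesis
    using True assms by (simp add: ratio_def norm_mult norm_divide norm_power)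
next
  case False
  then have "norm s \<le> norm a" "norm a > 0"
    using assms by linarith+
  then show ?thesis
    using False assms by (simp add: ratio_def norm_divide)
qed

text \<open>Since \<open>1 - ratio c a s\<close> equals
  \<open>outer_factor c a s / outer_factor c a 0\<close>, this is the nonvanishing of the outer
  factor.\<close>

lemma ratio_neq_1:
  assumes "c > 0" "norm s \<le> c" "norm a \<noteq> c"
  shows "ratio c a s \<noteq> 1"
  using outer_factor_nonzero[OF assms] assms
  by (auto simp: ratio_def outer_factor_def field_simps split: if_splits)

text \<open>The Moebius map \<open>1 / (1 - t)\<close> sends the unit circle without 1 to the line
  \<open>Re = 1/2\<close> and fixes the side by sending 0 to 1.\<close>

lemma Re_inverse_one_minus_ge_half:
  assumes "norm t \<le> 1" "t \<noteq> 1"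
  shows "Re (1 / (1 - t)) \<ge> 1/2"
proof -
  have "(Re t)\<^sup>2 + (Im t)\<^sup>2 \<le> 1"
    using assms(1) by (simp add: cmod_def)
  moreover have "(1 - Re t)\<^sup>2 + (Im t)\<^sup>2 > 0"
    using assms(2) by (auto simp: complex_eq_iff sum_power2_gt_zero_iff)
  ultimately show ?thesis
    by (simp add: Re_divide field_simps power2_eq_square)
qed

text \<open>On the circle \<open>c\<^sup>2 = s * cnj s\<close>, so for \<open>norm a < c\<close> the
  ratio is \<open>cnj (a / s)\<close>. Both resulting forms negate the imaginary part of
  \<open>s / (s - a)\<close>.\<close>

lemma ratio_circle:
  assumes "c > 0" "norm s = c" "norm a \<noteq> c"
  shows "1 / (1 - ratio c a s) =
    (if norm a < c then cnj (s / (s - a)) else 1 - s / (s - a))"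
proof (cases "norm a < c")
  case True
  have c2: "complex_of_real (c\<^sup>2) = s * cnj s"
    using assms by (simp flip: complex_norm_square)
  have "s \<noteq> 0" "s \<noteq> a" using assms by auto
  then show ?thesis
    using True by (simp add: ratio_def c2 divide_simps del: of_real_power)
next
  case False
  have "a \<noteq> 0" "s \<noteq> a" using assms False by auto
  then show ?thesis
    using False by (simp add: ratio_def field_simps)
qed

text \<open>Termwise bounds on norms would not carry over to the sums, so real and imaginary parts
  are compared separately.\<close>

lemma weighted_log_derivative_le:
  fixes z :: "'a \<Rightarrow> complex"
  assumes "\<And>k. k \<in> I \<Longrightarrow> 0 \<le> \<gamma> k"
    and c: "c > 0" "norm s = c" "\<And>k. k \<in> I \<Longrightarrow> norm (z k) \<noteq> c"
  shows "norm (\<Sum>k\<in>I. of_real (\<gamma> k) * (s / (s - z k)))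
       \<le> norm (\<Sum>k\<in>I. of_real (\<gamma> k) * (1 / (1 - ratio c (z k) s)))"
    (is "norm ?L \<le> norm ?R")
proof -
  have part: "\<bar>Re (s / (s - z k))\<bar> \<le> Re (1 / (1 - ratio c (z k) s))"
    "Im (1 / (1 - ratio c (z k) s)) = - Im (s / (s - z k))" if "k \<in> I" for k
  proof -
    have "Re (1 / (1 - ratio c (z k) s)) \<ge> 1/2"
      using that c by (intro Re_inverse_one_minus_ge_half norm_ratio_le_1 ratio_neq_1) auto
    \<comment> \<open>With \<open>r\<close> the real part on the right, the one on the left is
      \<open>r\<close> or \<open>1 - r\<close>, and \<open>r \<ge> 1/2\<close> gives
      \<open>\<bar>1 - r\<bar> \<le> r\<close>.\<close>
    then show "\<bar>Re (s / (s - z k))\<bar> \<le> Re (1 / (1 - ratio c (z k) s))"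
      "Im (1 / (1 - ratio c (z k) s)) = - Im (s / (s - z k))"
      unfolding ratio_circle[OF c(1,2) c(3)[OF that]]
      by (auto simp del: Re_divide Im_divide complex_cnj_divide complex_cnj_diff split: if_splits)
  qed
  have "\<bar>Re ?L\<bar> \<le> (\<Sum>k\<in>I. \<bar>\<gamma> k * Re (s / (s - z k))\<bar>)"
    by (simp add: sum_abs del: Re_divide times_divide_eq_right)
  also have "\<dots> \<le> Re ?R"
    using assms(1) part(1)
    by (auto simp: abs_mult simp del: Re_divide times_divide_eq_right intro!: sum_mono mult_left_mono)
  finally have "\<bar>Re ?L\<bar> \<le> \<bar>Re ?R\<bar>" by linarith
  \<comment> \<open>The sign is the same for every \<open>k\<close>, so any cancellation among
    imaginary parts is identical in both sums.\<close>
  moreover have "Im ?R = - Im ?L"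
    using part(2) by (simp add: sum_negf[symmetric] del: Im_divide times_divide_eq_right)
  ultimately show ?thesis
    unfolding cmod_def by (auto intro!: real_sqrt_le_mono add_mono simp: abs_le_square_iff)
qed

section \<open>Comparison of zeros by the maximum principle\<close>

lemma prod_max_zeros_le:
  fixes z :: "'a \<Rightarrow> complex" and w :: "'b \<Rightarrow> complex"
  assumes fin: "finite I"
    and gamma: "\<And>k. k \<in> I \<Longrightarrow> 0 \<le> \<gamma> k" "sum \<gamma> I = 1"
    and c: "c > 0" "\<And>k. k \<in> I \<Longrightarrow> norm (z k) \<noteq> c"
    and eq: "\<And>s. (\<Prod>j\<in>J. s - w j) = (\<Sum>k\<in>I. of_real (\<gamma> k) * (\<Prod>j\<in>I - {k}. s - z j))"
  shows "c * (\<Prod>j\<in>J. max c (norm (w j))) \<le> (\<Prod>k\<in>I. max c (norm (z k)))"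
proof -
  define P where "P s = (\<Prod>j\<in>J. outer_factor c (w j) s)" for s
  define Q where "Q s = (\<Prod>k\<in>I. outer_factor c (z k) s)" for s
  define H where "H s = (\<Sum>k\<in>I. of_real (\<gamma> k) * (1 / (1 - ratio c (z k) s)))" for s
  have Q_nz: "Q s \<noteq> 0" if "norm s \<le> c" for s
    using fin c that by (auto simp: Q_def outer_factor_nonzero)
  have "Re (H s) \<ge> 1/2" if "norm s \<le> c" for s
  proof -
    have "1/2 = (\<Sum>k\<in>I. \<gamma> k * (1/2))"
      using gamma(2) by (simp flip: sum_divide_distrib)
    also have "\<dots> \<le> (\<Sum>k\<in>I. \<gamma> k * Re (1 / (1 - ratio c (z k) s)))"
      using gamma(1) c that
      by (intro sum_mono mult_left_mono Re_inverse_one_minus_ge_half norm_ratio_le_1 ratio_neq_1) auto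
    finally show ?thesis by (simp add: H_def del: Re_divide times_divide_eq_right)
  qed
  then have H_nz: "H s \<noteq> 0" if "norm s \<le> c" for s
    using that by (metis zero_complex.sel(1) half_gt_zero less_le_not_le zero_less_one)
  \<comment> \<open>The constant \<open>c\<close> is the outer factor of the extra zero 0. As
    \<open>H 0 = 1\<close>, \<open>norm (f 0)\<close> is the quotient of the two sides of the
    claim.\<close>
  define f where "f s = of_real c * P s / (Q s * H s)" for s
  have ratio_hol: "ratio c a holomorphic_on S" if "norm a \<noteq> c" for a S
    using that c(1)
    by (cases "norm a < c") (auto simp: ratio_def[abs_def] intro!: holomorphic_intros)
  have hol: "f holomorphic_on cball 0 c"
    unfolding f_def P_def Q_def H_def
    using c Q_nz H_nz ratio_neq_1 unfolding Q_def H_def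
    by (intro holomorphic_intros ratio_hol) (auto simp: dist_norm)
  have bound: "norm (f s) \<le> 1" if s: "norm s = c" for s
  proof -
    have P: "norm (P s) = norm (\<Prod>j\<in>J. s - w j)"
      using s c(1) by (simp add: P_def norm_outer_factor_circle flip: prod_norm)
    have Q: "norm (Q s) = norm (\<Prod>k\<in>I. s - z k)"
      using s c(1) by (simp add: Q_def norm_outer_factor_circle flip: prod_norm)
    have "s * (\<Prod>j\<in>J. s - w j)
        = (\<Prod>k\<in>I. s - z k) * (\<Sum>k\<in>I. of_real (\<gamma> k) * (s / (s - z k)))"
      unfolding eq sum_distrib_left
    proof (rule sum.cong[OF refl])
      fix k assume k: "k \<in> I"
      then have "s - z k \<noteq> 0" using c(2) s by auto
      then show "s * (of_real (\<gamma> k) * (\<Prod>j\<in>I - {k}. s - z j))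
          = (\<Prod>j\<in>I. s - z j) * (of_real (\<gamma> k) * (s / (s - z k)))"
        unfolding prod.remove[OF fin k] by simp
    qed
    then have "c * norm (P s) = norm (Q s) * norm (\<Sum>k\<in>I. of_real (\<gamma> k) * (s / (s - z k)))"
      unfolding P Q by (metis norm_mult s)
    also have "\<dots> \<le> norm (Q s) * norm (H s)"
      unfolding H_def using gamma c s by (intro mult_left_mono weighted_log_derivative_le) auto
    finally show ?thesis
      using Q_nz[of s] H_nz[of s] s c(1) by (simp add: f_def norm_mult norm_divide)
  qed
  have "norm (f 0) \<le> 1"
  proof (rule maximum_modulus_frontier[of f "cball 0 c"])
    show "f holomorphic_on interior (cball 0 c)"
      using hol by (rule holomorphic_on_subset) (rule interior_subset)
    show "continuous_on (closure (cball 0 c)) f"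
      using hol by (simp add: holomorphic_on_imp_continuous_on)
  qed (use bound c(1) in auto)
  moreover have "ratio c a 0 = 0" for a
    by (simp add: ratio_def)
  then have "H 0 = 1"
    using gamma(2) by (simp add: H_def flip: of_real_sum)
  ultimately have "c * norm (P 0) \<le> norm (Q 0)"
    using Q_nz[of 0] c(1) by (simp add: f_def norm_mult norm_divide)
  then show ?thesis
    using c(1) by (simp add: P_def Q_def norm_outer_factor_0 flip: prod_norm)
qed

section \<open>Factorization of the generalized derivative\<close>

lemma degree_incomplete_poly:
  assumes "k \<in> {1..n}"
  shows "degree (incomplete_poly n z k) = n - 1"
  using assms by (simp add: incomplete_poly_def degree_prod_eq_sum_degree)

lemma monic_incomplete_poly: "lead_coeff (incomplete_poly n z k) = 1"
  by (simp add: incomplete_poly_def lead_coeff_prod)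

text \<open>The leading coefficients average to 1 under the weights. Monicity lets the zeros alone
  determine the polynomial.\<close>

lemma monic_gen_derivative:
  assumes "(\<Sum>k=1..n. \<gamma> k) = 1"
  shows "lead_coeff (gen_derivative n \<gamma> z) = 1"
proof -
  have "coeff (gen_derivative n \<gamma> z) (n - 1) = (\<Sum>k=1..n. of_real (\<gamma> k))"
    unfolding gen_derivative_def coeff_sum
  proof (rule sum.cong[OF refl])
    fix k assume "k \<in> {1..n}"
    then show "coeff (smult (of_real (\<gamma> k)) (incomplete_poly n z k)) (n - 1) = of_real (\<gamma> k)"
      using monic_incomplete_poly[of n z k] by (simp add: degree_incomplete_poly)
  qed
  then have coeff: "coeff (gen_derivative n \<gamma> z) (n - 1) = 1"
    using assms by (simp flip: of_real_sum)
  have "degree (gen_derivative n \<gamma> z) \<le> n - 1"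
    unfolding gen_derivative_def
    by (intro degree_sum_le)
       (auto intro: order_trans[OF degree_smult_le] simp: degree_incomplete_poly)
  moreover have "n - 1 \<le> degree (gen_derivative n \<gamma> z)"
    using coeff by (intro le_degree) simp
  ultimately show ?thesis using coeff by simp
qed

text \<open>Algebraic closedness gives linear factors over some multiset \<open>A\<close>; counting
  roots identifies \<open>A\<close> with \<open>proots p\<close>.\<close>

lemma poly_eq_prod_proots:
  fixes p :: "complex poly"
  shows "p = smult (lead_coeff p) (\<Prod>x\<in>#proots p. [:-x, 1:])"
proof (cases "p = 0")
  case False
  then obtain A where A: "p = smult (lead_coeff p) (\<Prod>x\<in>#A. [:-x, 1:])"
    using alg_closed_imp_factorization by blast
  have "proots p = proots (\<Prod>x\<in>#A. [:-x, 1:])"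
    using False by (subst A) simp
  also have "\<dots> = A"
  proof (induction A)
    case (add x A)
    have "(\<Prod>x\<in>#A. [:-x, 1:]) \<noteq> 0"
      by (auto simp: prod_mset_zero_iff)
    then have "proots ([:-x, 1:] * (\<Prod>x\<in>#A. [:-x, 1:])) = {#x#} + A"
      by (subst proots_mult) (simp_all add: add)
    then show ?case by simp
  qed simp
  finally show ?thesis using A by simp
qed simp

lemma gen_derivative_factorization:
  assumes "(\<Sum>k=1..n. \<gamma> k) = 1" "lists_zeros m w (gen_derivative n \<gamma> z)"
  shows "(\<Prod>j=1..m. s - w j) = (\<Sum>k=1..n. of_real (\<gamma> k) * (\<Prod>j\<in>{1..n} - {k}. s - z j))"
proof -
  have "gen_derivative n \<gamma> z = (\<Prod>j=1..m. [:- w j, 1:])"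
    using poly_eq_prod_proots[of "gen_derivative n \<gamma> z"] assms
    by (simp add: monic_gen_derivative lists_zeros_def image_mset.compositionality o_def
          prod_unfold_prod_mset flip: assms(2)[unfolded lists_zeros_def])
  then have "poly (gen_derivative n \<gamma> z) s = (\<Prod>j=1..m. s - w j)"
    by (simp add: poly_prod)
  then show ?thesis
    by (simp add: gen_derivative_def incomplete_poly_def poly_sum poly_prod)
qed

section \<open>Choice of the radius and passage to the limit\<close>

lemma eventually_at_right_notin_finite:
  fixes a :: real
  assumes "finite F"
  shows "eventually (\<lambda>x. x \<notin> F) (at_right a)"
proof -
  \<comment> \<open>The point \<open>a\<close> may lie in \<open>F\<close>; it is removed because a
    right-sided limit ignores it.\<close>
  have "open (- (F - {a}))"
    using assms by (intro open_Compl finite_imp_closed) auto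
  then show ?thesis
    unfolding eventually_at_topological by (intro exI[of _ "- (F - {a})"]) auto
qed

theorem theorem1p5:
  fixes n :: nat and z w :: "nat \<Rightarrow> complex" and \<gamma> :: "nat \<Rightarrow> real"
  assumes z_desc: "descending_modulus n z"
    and gamma_nonneg: "\<And>k. k \<in> {1..n} \<Longrightarrow> 0 \<le> \<gamma> k"
    and gamma_sum: "(\<Sum>k=1..n. \<gamma> k) = 1"
    and w_zeros: "lists_zeros (n - 1) w (gen_derivative n \<gamma> z)"
    and w_desc: "descending_modulus (n - 1) w"
    and w_last: "w n = 0"
  shows "\<forall>k\<in>{1..n}. (\<Prod>j=1..k. norm (w j)) \<le> (\<Prod>j=1..k. norm (z j))"
proof
  fix k assume k: "k \<in> {1..n}"
  have split: "(\<Prod>j=1..n. g j) = (\<Prod>j=1..k. g j) * (\<Prod>j\<in>{k<..n}. g j)" for g :: "nat \<Rightarrow> real"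
    using k by (subst prod.union_disjoint[symmetric]) (auto intro!: prod.cong)
  have bound: "(\<Prod>j=1..k. norm (w j)) \<le> (\<Prod>j=1..k. max c (norm (z j)))"
    if c: "norm (z k) < c" "c \<notin> (\<lambda>j. norm (z j)) ` {1..n}" for c
  proof -
    have "c > 0" using c(1) norm_ge_zero[of "z k"] by linarith
    have "(\<Prod>j=1..k. norm (w j)) * c ^ (n - k)
        \<le> (\<Prod>j=1..k. max c (norm (w j))) * (\<Prod>j\<in>{k<..n}. max c (norm (w j)))"
    proof (intro mult_mono)
      have "(\<Prod>j\<in>{k<..n}. c) \<le> (\<Prod>j\<in>{k<..n}. max c (norm (w j)))"
        using \<open>c > 0\<close> by (intro prod_mono) auto
      then show "c ^ (n - k) \<le> (\<Prod>j\<in>{k<..n}. max c (norm (w j)))" by simp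
    qed (use \<open>c > 0\<close> in \<open>auto intro!: prod_mono prod_nonneg simp: le_max_iff_disj\<close>)
    also have "\<dots> = (\<Prod>j=1..n. max c (norm (w j)))"
      by (rule split[symmetric])
    \<comment> \<open>The convention \<open>w n = 0\<close> makes the last factor exactly
      \<open>c\<close>.\<close>
    also have "\<dots> = c * (\<Prod>j=1..n - 1. max c (norm (w j)))"
      using k w_last \<open>c > 0\<close> by (cases n) (auto simp: mult.commute)
    also have "\<dots> \<le> (\<Prod>j=1..n. max c (norm (z j)))"
      using gamma_nonneg gamma_sum \<open>c > 0\<close> c(2) gen_derivative_factorization[OF gamma_sum w_zeros]
      by (intro prod_max_zeros_le) auto
    also have "\<dots> = (\<Prod>j=1..k. max c (norm (z j))) * (\<Prod>j\<in>{k<..n}. max c (norm (z j)))"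
      by (rule split)
    also have "(\<Prod>j\<in>{k<..n}. max c (norm (z j))) = (\<Prod>j\<in>{k<..n}. c)"
    proof (rule prod.cong[OF refl])
      \<comment> \<open>By the ordering the tail contributes exactly \<open>c ^ (n - k)\<close>,
        which cancels against the left-hand side.\<close>
      fix j assume "j \<in> {k<..n}"
      then have "norm (z j) \<le> norm (z k)"
        using z_desc k by (auto simp: descending_modulus_def)
      then show "max c (norm (z j)) = c" using c(1) by simp
    qed
    finally show ?thesis using \<open>c > 0\<close> by simp
  qed
  have "((\<lambda>c. \<Prod>j=1..k. max c (norm (z j))) \<longlongrightarrow> (\<Prod>j=1..k. max (norm (z k)) (norm (z j))))
      (at_right (norm (z k)))"
    by (intro tendsto_intros)
  then have "(\<Prod>j=1..k. norm (w j)) \<le> (\<Prod>j=1..k. max (norm (z k)) (norm (z j)))"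
  proof (rule tendsto_lowerbound)
    have "eventually (\<lambda>c. norm (z k) < c) (at_right (norm (z k)))"
      by (rule eventually_at_right_less)
    moreover have "eventually (\<lambda>c. c \<notin> (\<lambda>j. norm (z j)) ` {1..n}) (at_right (norm (z k)))"
      by (rule eventually_at_right_notin_finite) simp
    ultimately show "eventually (\<lambda>c. (\<Prod>j=1..k. norm (w j)) \<le> (\<Prod>j=1..k. max c (norm (z j))))
        (at_right (norm (z k)))"
      by eventually_elim (rule bound)
  qed simp
  \<comment> \<open>For \<open>j \<le> k\<close> the ordering gives
    \<open>norm (z k) \<le> norm (z j)\<close>, so in the limit each maximum collapses.\<close>
  also have "\<dots> = (\<Prod>j=1..k. norm (z j))"
    using z_desc k by (intro prod.cong) (auto simp: descending_modulus_def max_def)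
  finally show "(\<Prod>j=1..k. norm (w j)) \<le> (\<Prod>j=1..k. norm (z j))" .
qed

end
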